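(* If $w\in W$ is $\Phi$-finite, then $\Phi_w$ is a $\mathbb{Z}[X,Y]$-linear combination of the $\Phi_{w'}$ for all $\Phi$-irreducible $w'\in\mathrm{Desc}(w)$.
   Context: Let $T$ be the infinite rooted regular binary tree whose vertices are the finite words over $\{0,1\}$, with root the empty word, each word $t$ being joined by an edge to the words $0t$ and $1t$. Level $n$ of $T$ is the set of words of length $n$. Let $W=\mathrm{Aut}(T)$ be the automorphism group of $T$ (products are compositions, $(uv)(t)=u(v(t))$), with identity element $1$. For $u,v\in W$, let $(u,v)\in W$ be the automorphism fixing the root and given by $t0\mapsto u(t)0$ and $t1\mapsto v(t)1$ for every word $t$. Let $\sigma\in W$ be the involution fixing the root with $t0\mapsto t1$ and $t1\mapsto t0$ for every word $t$. Then $W=(W\times W)\rtimes\langle\sigma\rangle$, so every $w\in W$ can be written uniquely as $(u,v)$ or as $(u,v)\,\sigma$. For $w\in W$, every orbit of $w$ on level $n$ has length $2^m$ for some $0\le m\le n$. The orbit length generating function of $w$ is $\Phi_w=\sum_{n\ge m\ge 0}o_{m,n}(w)X^mY^n\in 1+Y\mathbb{Z}[[X,Y]]$, where $o_{m,n}(w)$ is the number of orbits of $w$ of length $2^m$ on level $n$. The first descendants of $w\in W$ are the elements $u$ and $v$ if $w=(u,v)$, respectively the single element $uv$ if $w=(u,v)\,\sigma$. For $n\ge1$, the first descendants of the $n$-th descendants of $w$ are the $(n+1)$-st descendants of $w$. $\mathrm{Desc}(w)$ is the set of all $n$-th descendants of $w$ for all $n\ge1$. An element $w$ is called $\Phi$-finite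 if $\mathrm{Desc}(w)$ is finite, and $\Phi$-irreducible if $\mathrm{Desc}(w)$ is finite and $w\in\mathrm{Desc}(w)$. *)

theory Defs
  imports
    "HOL-Combinatorics.Orbits"
    "HOL-Computational_Algebra.Polynomial_FPS"
begin

text \<open>Words over {0,1} are boolean lists, read from left to right, with 0 = False and 1 = True.
  Children are obtained by prepending a letter, so the subtree containing a word is determined
  by its last letter.\<close>

type_synonym word = "bool list"

definition adjacent :: "word \<Rightarrow> word \<Rightarrow> bool" where
  "adjacent s t \<longleftrightarrow> (\<exists>a. t = a # s \<or> s = a # t)"

definition level :: "nat \<Rightarrow> word set" where
  "level n = {t. length t = n}"

definition W :: "(word \<Rightarrow> word) set" where
  "W = {w. bij w \<and> w [] = [] \<and> (\<forall>s t. adjacent (w s) (w t) \<longleftrightarrow> adjacent s t)}"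

definition tpair :: "(word \<Rightarrow> word) \<Rightarrow> (word \<Rightarrow> word) \<Rightarrow> word \<Rightarrow> word" where
  "tpair u v t =
     (if t = [] then []
      else if last t then v (butlast t) @ [True]
      else u (butlast t) @ [False])"

definition sigma :: "word \<Rightarrow> word" where
  "sigma t = (if t = [] then [] else butlast t @ [\<not> last t])"

definition orbit_count :: "nat \<Rightarrow> nat \<Rightarrow> (word \<Rightarrow> word) \<Rightarrow> nat" where
  "orbit_count m n w = card {A \<in> orbit w ` level n. card A = 2 ^ m}"

text \<open>The ring Z[[X,Y]] is modelled as Z[[X]][[Y]]: the outer variable is Y, the inner one X.
  Likewise Z[X,Y] is modelled as Z[X][Y].\<close>

definition orbit_gf :: "(word \<Rightarrow> word) \<Rightarrow> int fps fps" where
  "orbit_gf w = Abs_fps (\<lambda>n. Abs_fps (\<lambda>m. if m \<le> n then int (orbit_count m n w) else 0))"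

definition fps2_of_poly2 :: "int poly poly \<Rightarrow> int fps fps" where
  "fps2_of_poly2 p = fps_of_poly (map_poly fps_of_poly p)"

definition first_descendants :: "(word \<Rightarrow> word) \<Rightarrow> (word \<Rightarrow> word) set" where
  "first_descendants w =
     {x. \<exists>u\<in>W. \<exists>v\<in>W. (w = tpair u v \<and> (x = u \<or> x = v)) \<or>
                       (w = tpair u v \<circ> sigma \<and> x = u \<circ> v)}"

primrec nth_descendants :: "nat \<Rightarrow> (word \<Rightarrow> word) \<Rightarrow> (word \<Rightarrow> word) set" where
  "nth_descendants 0 w = {w}"
| "nth_descendants (Suc n) w = (\<Union>x\<in>nth_descendants n w. first_descendants x)"

definition Desc :: "(word \<Rightarrow> word) \<Rightarrow> (word \<Rightarrow> word) set" where
  "Desc w = (\<Union>n\<in>{1..}. nth_descendants n w)"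

definition Phi_finite :: "(word \<Rightarrow> word) \<Rightarrow> bool" where
  "Phi_finite w \<longleftrightarrow> finite (Desc w)"

definition Phi_irreducible :: "(word \<Rightarrow> word) \<Rightarrow> bool" where
  "Phi_irreducible w \<longleftrightarrow> finite (Desc w) \<and> w \<in> Desc w"

end

theory Submission
  imports Defs
begin

text \<open>Splitting orbits over the two subtrees gives \<open>\<Phi> = 1 + Y (\<Phi>\<^sub>u + \<Phi>\<^sub>v)\<close> for \<open>(u,v)\<close> and
  \<open>\<Phi> = 1 + X Y \<Phi>\<^sub>u\<^sub>v\<close> for \<open>(u,v) \<sigma>\<close>. If \<open>x\<close> is a descendant with \<open>card (Desc x)\<close> minimal, then every
  element of \<open>Desc x\<close> is irreducible, so solving the recursion at such an element for the
  constant term puts \<open>1\<close> into the span of the irreducible \<open>\<Phi>\<close>. Passing from a reducible element to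
  one of its first descendants strictly shrinks \<open>Desc\<close> or reaches an irreducible element,
  so the recursion then expresses every \<open>\<Phi>\<close>.\<close>

unbundle fps_syntax

section \<open>The structure of tree automorphisms\<close>

lemma adjacent_snoc [simp]: "adjacent (s @ [a]) (t @ [a]) \<longleftrightarrow> adjacent s t"
  by (auto simp: adjacent_def simp flip: append_Cons)

lemma W_D:
  assumes "w \<in> W"
  shows "bij w" "w [] = []" "adjacent (w s) (w t) \<longleftrightarrow> adjacent s t"
  using assms by (auto simp: W_def)

lemma W_inj: "w \<in> W \<Longrightarrow> inj w"
  using W_D(1) bij_is_inj by blast

lemma W_comp: "u \<in> W \<Longrightarrow> v \<in> W \<Longrightarrow> u \<circ> v \<in> W"
  by (auto simp: W_def intro: bij_comp)

text \<open>By induction from the root, adjacency and injectivity together force an automorphism to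
  send the parent \<open>tl\<close> of a word to the parent of its image.\<close>

lemma W_tl:
  assumes w: "w \<in> W"
  shows "w (a # t) \<noteq> [] \<and> tl (w (a # t)) = w t"
proof (induction t arbitrary: a)
  case Nil
  have "adjacent (w []) (w [a])"
    using W_D(3)[OF w] by (auto simp: adjacent_def)
  then show ?case
    using W_D(2)[OF w] by (auto simp: adjacent_def)
next
  case (Cons c t)
  have "adjacent (w (c # t)) (w (a # c # t))"
    using W_D(3)[OF w] by (auto simp: adjacent_def)
  \<comment> \<open>The only other way to be adjacent is for the image of the child to be the parent
    of \<open>w (c # t)\<close>. By induction that parent is \<open>w t\<close>, so a word would
    equal its own grandparent.\<close>
  moreover have "w (c # t) \<noteq> b # w (a # c # t)" for b
  proof
    assume "w (c # t) = b # w (a # c # t)"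
    then have "w (a # c # t) = w t"
      using Cons.IH[of c] by simp
    then have "a # c # t = t"
      using W_inj[OF w] by (simp add: inj_eq)
    from arg_cong[OF this, of length] show False by simp
  qed
  ultimately show ?case
    by (auto simp: adjacent_def)
qed

lemma W_Cons:
  assumes "w \<in> W"
  obtains b where "w (a # t) = b # w t"
  using W_tl[OF assms, of a t] by (metis list.collapse)

lemma W_length [simp]:
  assumes "w \<in> W"
  shows "length (w t) = length t"
proof (induction t)
  case Nil
  then show ?case using W_D(2)[OF assms] by simp
next
  case (Cons a t)
  then show ?case using W_Cons[OF assms, of a t] by (metis length_Cons)
qed

text \<open>By \<open>W_Cons\<close>, prepending a letter to a word only prepends a letter to its
  image. Hence the action on level 1 decides which subtree goes where.\<close>

lemma W_last:
  assumes w: "w \<in> W"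
  shows "last (w (t @ [a])) = last (w [a])"
proof (induction t)
  case (Cons b t)
  obtain c where "w (b # t @ [a]) = c # w (t @ [a])"
    using W_Cons[OF w] by metis
  moreover have "w (t @ [a]) \<noteq> []"
    using W_length[OF w, of "t @ [a]"] by auto
  ultimately show ?case
    using Cons by simp
qed simp

section \<open>Decomposition of an automorphism as (u,v) or (u,v) sigma\<close>

lemma sigma_snoc [simp]: "sigma (t @ [a]) = t @ [\<not> a]"
  and sigma_Nil [simp]: "sigma [] = []"
  by (simp_all add: sigma_def)

lemma tpair_snoc [simp]:
  "tpair u v (t @ [True]) = v t @ [True]"
  "tpair u v (t @ [False]) = u t @ [False]"
  and tpair_Nil [simp]: "tpair u v [] = []"
  by (simp_all add: tpair_def)

lemma sigma_sigma [simp]: "sigma (sigma t) = t"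
  by (cases t rule: rev_cases) simp_all

lemma adjacent_sigma [simp]: "adjacent (sigma s) (sigma t) \<longleftrightarrow> adjacent s t"
  by (cases s rule: rev_cases; cases t rule: rev_cases)
     (auto simp: adjacent_def append_eq_Cons_conv Cons_eq_append_conv)

lemma sigma_in_W: "sigma \<in> W"
  by (auto simp: W_def intro: involuntory_imp_bij)

text \<open>The action on a preserved subtree is again an automorphism. The delicate point is
  surjectivity: a preimage of a word in the subtree must lie in that same subtree.\<close>

lemma W_restrict:
  assumes w: "w \<in> W" and u: "\<And>t. w (t @ [a]) = u t @ [a]"
  shows "u \<in> W"
proof -
  have len: "length (u t) = length t" for t
    using W_length[OF w, of "t @ [a]"] u by simp
  have "inj u"
  proof (rule injI)
    fix s t assume "u s = u t"
    then have "w (s @ [a]) = w (t @ [a])" by (simp add: u)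
    then show "s = t" using W_inj[OF w] by (simp add: inj_eq)
  qed
  moreover have "surj u"
    unfolding surj_def
  proof
    fix s
    obtain t where t: "w t = s @ [a]"
      using W_D(1)[OF w] by (metis bij_pointE)
    have "t \<noteq> []" using t W_D(2)[OF w] by auto
    then obtain t' b where t': "t = t' @ [b]"
      by (metis append_butlast_last_id)
    have "length (w [b]) = 1" "length (w [a]) = 1"
      using w by simp_all
    moreover have "last (w [b]) = a" "last (w [a]) = a"
      using W_last[OF w, of t' b] t t' u[of "[]"] by auto
    ultimately have "w [b] = w [a]"
      by (auto simp: length_Suc_conv)
    then have "b = a" using W_inj[OF w] by (simp add: inj_eq)
    then show "\<exists>t. s = u t" using t t' u by auto
  qed
  moreover have "u [] = []" using len[of "[]"] by simp
  moreover have "adjacent (u s) (u t) \<longleftrightarrow> adjacent s t" for s t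
    using W_D(3)[OF w, of "s @ [a]" "t @ [a]"] by (simp add: u)
  ultimately show ?thesis by (auto simp: W_def bij_def)
qed

lemma W_eq_tpair:
  assumes w: "w \<in> W" and last_fixed: "\<And>a. w [a] = [a]"
  shows "\<exists>u\<in>W. \<exists>v\<in>W. w = tpair u v"
proof -
  define r where "r a t = butlast (w (t @ [a]))" for a t
  have r: "w (t @ [a]) = r a t @ [a]" for a t
  proof -
    have "w (t @ [a]) \<noteq> []" using W_length[OF w, of "t @ [a]"] by auto
    moreover have "last (w (t @ [a])) = a" using W_last[OF w] last_fixed by simp
    ultimately show ?thesis
      using append_butlast_last_id[of "w (t @ [a])"] by (simp add: r_def)
  qed
  have "w t = tpair (r False) (r True) t" for t
  proof (cases t rule: rev_cases)
    case Nil
    then show ?thesis using W_D(2)[OF w] by simp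
  next
    case (snoc s a)
    then show ?thesis by (cases a) (simp_all add: r)
  qed
  then show ?thesis using W_restrict[OF w r] by blast
qed

text \<open>On level 1 there are only two permutations. If \<open>w\<close> swaps the two letters,
  then \<open>w \<circ> sigma\<close> fixes them, and the involution \<open>sigma\<close> is moved
  back to the other side.\<close>

lemma W_cases:
  assumes w: "w \<in> W"
  obtains u v where "u \<in> W" "v \<in> W" "w = tpair u v"
  | u v where "u \<in> W" "v \<in> W" "w = tpair u v \<circ> sigma"
proof -
  have len: "length (w [a]) = 1" for a using w by simp
  have ne: "w [True] \<noteq> w [False]" using W_inj[OF w] by (simp add: inj_eq)
  obtain p q where pq: "w [True] = [p]" "w [False] = [q]"
    using len[of True] len[of False] by (auto simp: length_Suc_conv)
  show thesis
  proof (cases p)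
    case True
    with pq ne have "w [a] = [a]" for a by (cases a) auto
    then show thesis using W_eq_tpair[OF w] that(1) by blast
  next
    case False
    have "(w \<circ> sigma) [a] = [a]" for a
      using False pq ne sigma_snoc[of "[]" a] by (cases a) auto
    then obtain u v where "u \<in> W" "v \<in> W" "w \<circ> sigma = tpair u v"
      using W_eq_tpair[OF W_comp[OF w sigma_in_W]] by blast
    moreover from this have "w = tpair u v \<circ> sigma"
      by (metis comp_apply ext sigma_sigma)
    ultimately show thesis using that(2) by blast
  qed
qed

section \<open>Orbits on the levels\<close>

lemma W_level: "w \<in> W \<Longrightarrow> w t \<in> level n \<longleftrightarrow> t \<in> level n"
  by (simp add: level_def)

lemma finite_level: "finite (level n)"
  using finite_lists_length_eq[of "UNIV :: bool set" n] by (simp add: level_def)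

lemma card_level: "card (level n) = 2 ^ n"
  using card_lists_length_eq[of "UNIV :: bool set" n] by (simp add: level_def)

lemma level_Suc: "level (Suc n) = (\<lambda>t. t @ [False]) ` level n \<union> (\<lambda>t. t @ [True]) ` level n"
proof -
  have "t \<in> (\<lambda>t. t @ [False]) ` level n \<union> (\<lambda>t. t @ [True]) ` level n" if "t \<in> level (Suc n)" for t
    using that by (cases t rule: rev_cases) (auto simp: level_def image_iff)
  then show ?thesis by (auto simp: level_def)
qed

lemma orbit_subset_level:
  assumes "w \<in> W" "t \<in> level n"
  shows "orbit w t \<subseteq> level n"
proof
  fix s assume "s \<in> orbit w t"
  then show "s \<in> level n" by induction (use assms in \<open>simp_all add: W_level\<close>)
qed

text \<open>The library's \<open>orbit w t\<close> starts at \<open>w t\<close>, so it contains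
  \<open>t\<close> only if \<open>t\<close> is periodic. Here it is, since \<open>w\<close> is
  injective and all iterates stay in one finite level.\<close>

lemma W_self_in_orbit:
  assumes w: "w \<in> W"
  shows "t \<in> orbit w t"
proof -
  have "(w ^^ k) t \<in> level (length t)" for k
    by (induction k) (use w in \<open>simp_all add: level_def\<close>)
  then have "finite {s. \<exists>k. s = (w ^^ k) t}"
    by (intro finite_subset[OF _ finite_level]) auto
  then obtain k where "k > 0" "(w ^^ k) t = t"
    using funpow_inj_finite[OF W_inj[OF w]] by metis
  then show ?thesis by (force simp: orbit_altdef)
qed

lemma orbit_semiconj:
  assumes "\<And>t. w (h t) = h (u t)"
  shows "orbit w (h t) = h ` orbit u t"
proof (intro equalityI subsetI)
  fix s assume "s \<in> orbit w (h t)"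
  then show "s \<in> h ` orbit u t"
    by induction (auto simp: assms intro: orbit.intros)
next
  fix s assume "s \<in> h ` orbit u t"
  then obtain r where "r \<in> orbit u t" "s = h r" by blast
  from this(1) have "h r \<in> orbit w (h t)"
    by induction (simp_all flip: assms add: orbit.intros)
  then show "s \<in> orbit w (h t)" using \<open>s = h r\<close> by simp
qed

text \<open>Describes \<open>w = (u,v) sigma\<close> with \<open>x = u \<circ> v\<close>: the
  iterates alternate between the subtrees, the even ones following \<open>x\<close> in the 0-subtree
  and the odd ones being shifted by \<open>v\<close> into the 1-subtree.\<close>

lemma orbit_swap_subtrees:
  assumes self: "t \<in> orbit x t"
    and w: "\<And>t. w (t @ [False]) = v t @ [True]" "\<And>t. w (v t @ [True]) = x t @ [False]"
  shows "orbit w (t @ [False]) = (\<lambda>t. t @ [False]) ` orbit x t \<union> (\<lambda>t. v t @ [True]) ` orbit x t"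
    (is "_ = ?R")
proof (intro equalityI subsetI)
  fix s assume "s \<in> orbit w (t @ [False])"
  then show "s \<in> ?R"
    \<comment> \<open>The first point is \<open>v t @ [True]\<close>, which is of the required form
      because \<open>t\<close> lies in its own orbit.\<close>
    by induction (use self in \<open>auto simp: w intro: orbit.step\<close>)
next
  fix s assume s: "s \<in> ?R"
  have "r @ [False] \<in> orbit w (t @ [False])" if "r \<in> orbit x t" for r
    using that
  proof induction
    case base
    have "w (w (t @ [False])) \<in> orbit w (t @ [False])"
      by (intro orbit.intros)
    then show ?case by (simp add: w)
  next
    case (step r)
    have "w (w (r @ [False])) \<in> orbit w (t @ [False])"
      by (intro orbit.step step.IH)
    then show ?case by (simp add: w)
  qed
  moreover from orbit.step[OF this]
  have "v r @ [True] \<in> orbit w (t @ [False])" if "r \<in> orbit x t" for r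
    using that by (simp add: w)
  ultimately show "s \<in> orbit w (t @ [False])" using s by auto
qed

section \<open>Orbit counts of (u,v) and (u,v) sigma\<close>

lemma inj_snoc: "inj (\<lambda>t. t @ [a])"
  by (simp add: inj_def)

text \<open>Each orbit stays inside one subtree, where it is a copy of an orbit of \<open>u\<close>
  or \<open>v\<close> of the same size. The two families are disjoint because orbits are nonempty
  and the last letters differ.\<close>

lemma orbit_count_tpair:
  "orbit_count m (Suc n) (tpair u v) = orbit_count m n u + orbit_count m n v"
proof -
  define P where "P w = {A \<in> orbit w ` level n. card A = 2 ^ m}" for w :: "word \<Rightarrow> word"
  define h where "h a = image (\<lambda>t::word. t @ [a])" for a
  have fin: "finite (h a ` P w)" for a w
    using finite_level by (simp add: P_def)
  have card: "card (h a A) = card A" for a A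
    unfolding h_def by (intro card_image inj_on_subset[OF inj_snoc]) simp
  have inj: "inj (h a)" for a
    unfolding h_def using inj_snoc by (simp add: inj_image_eq_iff inj_def)
  have orbF: "orbit (tpair u v) (t @ [False]) = h False (orbit u t)" for t
    unfolding h_def by (rule orbit_semiconj) simp
  have orbT: "orbit (tpair u v) (t @ [True]) = h True (orbit v t)" for t
    unfolding h_def by (rule orbit_semiconj) simp
  have "orbit (tpair u v) ` level (Suc n) = h False ` orbit u ` level n \<union> h True ` orbit v ` level n"
    by (simp add: level_Suc image_Un image_image orbF orbT)
  then have "{A \<in> orbit (tpair u v) ` level (Suc n). card A = 2 ^ m} = h False ` P u \<union> h True ` P v"
    by (auto simp: P_def card)
  moreover have "h False ` P u \<inter> h True ` P v = {}"
  proof -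
    have False if "A \<in> P u" "B \<in> P v" "h False A = h True B" for A B
    proof -
      have "A \<noteq> {}" using \<open>A \<in> P u\<close> by (auto simp: P_def orbit_nonempty)
      then obtain s where "s \<in> A" by blast
      then have "s @ [False] \<in> h True B" using that(3) by (auto simp: h_def)
      then show False by (auto simp: h_def)
    qed
    then show ?thesis by blast
  qed
  ultimately have "orbit_count m (Suc n) (tpair u v) = card (h False ` P u) + card (h True ` P v)"
    by (simp add: orbit_count_def card_Un_disjoint fin)
  then show ?thesis
    by (simp add: orbit_count_def P_def card_image[OF inj_on_subset[OF inj]])
qed

text \<open>Each orbit meets the two subtrees in equally many words, and its part in the 0-subtree
  is a copy of an orbit of \<open>u \<circ> v\<close>. Lengths therefore double, and length 1 cannot
  occur.\<close>

lemma
  assumes u: "u \<in> W" and v: "v \<in> W"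
  shows orbit_count_tpair_sigma_0: "orbit_count 0 (Suc n) (tpair u v \<circ> sigma) = 0"
    and orbit_count_tpair_sigma_Suc:
      "orbit_count (Suc m) (Suc n) (tpair u v \<circ> sigma) = orbit_count m n (u \<circ> v)"
proof -
  let ?w = "tpair u v \<circ> sigma"
  note uv = W_comp[OF u v]
  define F where "F A = (\<lambda>t::word. t @ [False]) ` A \<union> (\<lambda>t. v t @ [True]) ` A" for A
  have orbF: "orbit ?w (t @ [False]) = F (orbit (u \<circ> v) t)" for t
    unfolding F_def using W_self_in_orbit[OF uv] by (rule orbit_swap_subtrees) simp_all
  \<comment> \<open>Since \<open>v t @ [True]\<close> is the image of \<open>t @ [False]\<close>,
    starting in the 1-subtree yields no further orbits. As \<open>v\<close> permutes the level, all
    words of the 1-subtree are of this form.\<close>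
  have orbT: "orbit ?w (v t @ [True]) = orbit ?w (t @ [False])" for t
  proof -
    have "t @ [False] \<in> orbit ?w (t @ [False])"
      using orbF W_self_in_orbit[OF uv] by (auto simp: F_def)
    from self_in_orbit_step[OF this] show ?thesis by simp
  qed
  have vlevel: "level n = v ` level n"
  proof (intro equalityI subsetI)
    fix t assume t: "t \<in> level n"
    obtain s where "v s = t" using W_D(1)[OF v] by (metis bij_pointE)
    then show "t \<in> v ` level n" using t W_level[OF v] by blast
  qed (use W_level[OF v] in auto)
  have "level (Suc n) = (\<lambda>t. t @ [False]) ` level n \<union> (\<lambda>t. v t @ [True]) ` level n"
    by (subst level_Suc, subst (2) vlevel) (simp only: image_image)
  then have "orbit ?w ` level (Suc n) =
      (\<lambda>t. orbit ?w (t @ [False])) ` level n \<union> (\<lambda>t. orbit ?w (v t @ [True])) ` level n"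
    by (simp only: image_Un image_image)
  then have orb: "orbit ?w ` level (Suc n) = F ` orbit (u \<circ> v) ` level n"
    by (simp only: orbT orbF image_image Un_absorb)
  have card: "card (F A) = 2 * card A" if "A \<in> orbit (u \<circ> v) ` level n" for A
  proof -
    have "finite A"
      using that orbit_subset_level[OF uv] finite_level finite_subset by blast
    moreover have "inj (\<lambda>t. v t @ [True])"
      using W_inj[OF v] by (simp add: inj_def)
    ultimately show ?thesis unfolding F_def
      by (subst card_Un_disjoint)
         (auto simp: card_image[OF inj_on_subset[OF inj_snoc]] card_image[OF inj_on_subset])
  qed
  \<comment> \<open>The set \<open>A\<close> is recovered from \<open>F A\<close> as its part in the
    0-subtree.\<close>
  have "inj F"
  proof (rule injI)
    fix A B assume "F A = F B"
    moreover have "A = {t. t @ [False] \<in> F A}" for A by (auto simp: F_def)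
    ultimately show "A = B" by metis
  qed
  show "orbit_count 0 (Suc n) ?w = 0"
    unfolding orbit_count_def orb using card by (auto simp: card_eq_0_iff)
  have "{A \<in> orbit ?w ` level (Suc n). card A = 2 ^ Suc m} =
      F ` {A \<in> orbit (u \<circ> v) ` level n. card A = 2 ^ m}"
    unfolding orb using card by auto
  then show "orbit_count (Suc m) (Suc n) ?w = orbit_count m n (u \<circ> v)"
    unfolding orbit_count_def by (simp add: card_image[OF inj_on_subset[OF \<open>inj F\<close>]])
qed

text \<open>An orbit on level n has at most 2^n elements. This makes the cutoff
  \<open>m \<le> n\<close> in \<open>orbit_gf\<close> harmless.\<close>

lemma orbit_count_eq_0:
  assumes w: "w \<in> W" and "n < m"
  shows "orbit_count m n w = 0"
proof -
  have "card A \<noteq> 2 ^ m" if "A \<in> orbit w ` level n" for A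
  proof -
    have "card A \<le> 2 ^ n"
      using that orbit_subset_level[OF w] card_mono[OF finite_level] card_level by fastforce
    also have "\<dots> < 2 ^ m" using \<open>n < m\<close> by simp
    finally show ?thesis by simp
  qed
  then show ?thesis by (auto simp: orbit_count_def card_eq_0_iff)
qed

section \<open>Functional equations of the generating functions\<close>

lemma orbit_gf_nth:
  "w \<in> W \<Longrightarrow> orbit_gf w $ n $ m = int (orbit_count m n w)"
  by (auto simp: orbit_gf_def orbit_count_eq_0)

lemma orbit_gf_nth_0:
  assumes w: "w \<in> W"
  shows "orbit_gf w $ 0 = 1"
proof (rule fps_ext)
  fix m
  have "orbit w [] = {[]}"
    using orbit_subset_level[OF w, of "[]" 0] W_self_in_orbit[OF w, of "[]"] by (auto simp: level_def)
  moreover have "level 0 = {[]}" by (auto simp: level_def)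
  ultimately have "orbit w ` level 0 = {{[]}}" by simp
  then have "{A \<in> orbit w ` level 0. card A = 2 ^ 0} = {{[]}}" by (simp add: Collect_conv_if)
  then have "orbit_count 0 0 w = 1" by (simp only: orbit_count_def) simp
  then show "orbit_gf w $ 0 $ m = 1 $ m"
    by (simp add: orbit_gf_def)
qed

lemma orbit_gf_tpair:
  assumes "u \<in> W" "v \<in> W" "tpair u v \<in> W"
  shows "orbit_gf (tpair u v) = 1 + fps_X * (orbit_gf u + orbit_gf v)"
proof (rule fps_ext)
  fix n
  show "orbit_gf (tpair u v) $ n = (1 + fps_X * (orbit_gf u + orbit_gf v)) $ n"
  proof (cases n)
    case 0
    then show ?thesis using assms by (simp add: orbit_gf_nth_0)
  next
    case (Suc k)
    then show ?thesis
      using assms by (intro fps_ext) (simp add: orbit_gf_nth orbit_count_tpair)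
  qed
qed

text \<open>The outer \<open>fps_X\<close> is Y and records the extra level;
  \<open>fps_const fps_X\<close> is X and records the doubled orbit length.\<close>

lemma orbit_gf_tpair_sigma:
  assumes "u \<in> W" "v \<in> W" "tpair u v \<circ> sigma \<in> W"
  shows "orbit_gf (tpair u v \<circ> sigma) = 1 + fps_X * (fps_const fps_X * orbit_gf (u \<circ> v))"
proof (rule fps_ext)
  fix n
  show "orbit_gf (tpair u v \<circ> sigma) $ n = (1 + fps_X * (fps_const fps_X * orbit_gf (u \<circ> v))) $ n"
  proof (cases n)
    case 0
    then show ?thesis using assms by (simp add: orbit_gf_nth_0)
  next
    case (Suc k)
    \<comment> \<open>After a coefficient of Y has been extracted, this \<open>fps_X\<close> is the
      inner variable X. For \<open>m = 0\<close> both sides vanish.\<close>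
    have "orbit_gf (tpair u v \<circ> sigma) $ Suc k $ m = (fps_X * orbit_gf (u \<circ> v) $ k) $ m" for m
      using assms by (cases m)
        (simp_all add: orbit_gf_nth W_comp orbit_count_tpair_sigma_0 orbit_count_tpair_sigma_Suc
          del: o_apply)
    then show ?thesis using Suc by (intro fps_ext) simp
  qed
qed

section \<open>Linear combinations with polynomial coefficients\<close>

lemma fps2_of_poly2_nth [simp]: "fps2_of_poly2 p $ n = fps_of_poly (coeff p n)"
  by (simp add: fps2_of_poly2_def coeff_map_poly)

lemma fps2_of_poly2_0 [simp]: "fps2_of_poly2 0 = 0"
  by (rule fps_ext) simp

lemma fps2_of_poly2_1 [simp]: "fps2_of_poly2 1 = 1"
  by (rule fps_ext) (simp add: coeff_1)

lemma fps2_of_poly2_add: "fps2_of_poly2 (p + q) = fps2_of_poly2 p + fps2_of_poly2 q"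
  by (rule fps_ext) (simp add: fps_of_poly_add)

lemma fps2_of_poly2_uminus: "fps2_of_poly2 (- p) = - fps2_of_poly2 p"
  by (rule fps_ext) (simp add: fps_of_poly_uminus)

lemma fps2_of_poly2_mult: "fps2_of_poly2 (p * q) = fps2_of_poly2 p * fps2_of_poly2 q"
  by (rule fps_ext)
     (simp add: fps_mult_nth coeff_mult fps_of_poly_sum fps_of_poly_mult atLeast0AtMost)

lemma fps2_of_poly2_X: "fps2_of_poly2 [:[:0, 1:]:] = fps_const fps_X"
  by (rule fps_ext) (simp add: coeff_pCons split: nat.split)

lemma fps2_of_poly2_Y: "fps2_of_poly2 [:0, 1:] = fps_X"
  by (rule fps_ext) (auto simp: coeff_pCons fps_X_def split: nat.split)

text \<open>For finite \<open>S\<close> this is the Z[X,Y]-submodule generated by the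
  \<open>g x\<close>. Coefficients are indexed by the elements of \<open>S\<close> rather than by
  their series, since distinct automorphisms may share a series.\<close>

definition poly2_span :: "('a \<Rightarrow> int fps fps) \<Rightarrow> 'a set \<Rightarrow> int fps fps set" where
  "poly2_span g S = {f. \<exists>c. f = (\<Sum>x\<in>S. fps2_of_poly2 (c x) * g x)}"

text \<open>The coefficients are the indicator of \<open>x\<close>. Finiteness of \<open>S\<close>
  matters because a sum over an infinite set is 0 by convention.\<close>

lemma poly2_span_base:
  assumes "finite S" "x \<in> S"
  shows "g x \<in> poly2_span g S"
proof -
  have "(\<Sum>y\<in>S. fps2_of_poly2 (if y = x then 1 else 0) * g y) = (\<Sum>y\<in>S. if y = x then g y else 0)"
    by (rule sum.cong) auto
  also have "\<dots> = g x" using assms by simp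
  finally show ?thesis
    unfolding poly2_span_def by (intro CollectI exI) (rule sym)
qed

lemma poly2_span_add:
  assumes "f \<in> poly2_span g S" "h \<in> poly2_span g S"
  shows "f + h \<in> poly2_span g S"
proof -
  obtain c d where "f = (\<Sum>x\<in>S. fps2_of_poly2 (c x) * g x)" "h = (\<Sum>x\<in>S. fps2_of_poly2 (d x) * g x)"
    using assms by (auto simp: poly2_span_def)
  then have "f + h = (\<Sum>x\<in>S. fps2_of_poly2 (c x + d x) * g x)"
    by (simp add: fps2_of_poly2_add distrib_right sum.distrib)
  then show ?thesis unfolding poly2_span_def by (intro CollectI exI)
qed

lemma poly2_span_scale:
  assumes "f \<in> poly2_span g S"
  shows "fps2_of_poly2 p * f \<in> poly2_span g S"
proof -
  obtain c where "f = (\<Sum>x\<in>S. fps2_of_poly2 (c x) * g x)"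
    using assms by (auto simp: poly2_span_def)
  then have "fps2_of_poly2 p * f = (\<Sum>x\<in>S. fps2_of_poly2 (p * c x) * g x)"
    by (simp add: fps2_of_poly2_mult sum_distrib_left mult.assoc)
  then show ?thesis unfolding poly2_span_def by (intro CollectI exI)
qed

lemma poly2_span_X: "f \<in> poly2_span g S \<Longrightarrow> fps_const fps_X * f \<in> poly2_span g S"
  and poly2_span_Y: "f \<in> poly2_span g S \<Longrightarrow> fps_X * f \<in> poly2_span g S"
  by (metis poly2_span_scale fps2_of_poly2_X, metis poly2_span_scale fps2_of_poly2_Y)

lemma poly2_span_diff:
  assumes "f \<in> poly2_span g S" "h \<in> poly2_span g S"
  shows "f - h \<in> poly2_span g S"
  using poly2_span_add[OF assms(1) poly2_span_scale[OF assms(2), of "- 1"]]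
  by (simp add: fps2_of_poly2_uminus)

section \<open>Descendants\<close>

lemma first_descendants_W: "y \<in> first_descendants x \<Longrightarrow> y \<in> W"
  by (auto simp: first_descendants_def W_comp)

lemma first_descendants_intros:
  assumes "u \<in> W" "v \<in> W"
  shows "u \<in> first_descendants (tpair u v)" "v \<in> first_descendants (tpair u v)"
    "u \<circ> v \<in> first_descendants (tpair u v \<circ> sigma)"
  using assms unfolding first_descendants_def by blast+

lemma first_descendants_nonempty:
  assumes "x \<in> W"
  shows "first_descendants x \<noteq> {}"
  using assms
proof (cases rule: W_cases)
  case (1 u v)
  then show ?thesis using first_descendants_intros(1) by blast
next
  case (2 u v)
  then show ?thesis using first_descendants_intros(3) by blast
qed

text \<open>A uniform form of the two functional equations. It is used both to solve for 1 and to
  build the series of \<open>x\<close> from those of its first descendants.\<close>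

lemma orbit_gf_minus_one_in_span:
  assumes "x \<in> W" and "\<And>y. y \<in> first_descendants x \<Longrightarrow> orbit_gf y \<in> poly2_span g S"
  shows "orbit_gf x - 1 \<in> poly2_span g S"
  using assms(1)
proof (cases rule: W_cases)
  case (1 u v)
  then have "orbit_gf u \<in> poly2_span g S" "orbit_gf v \<in> poly2_span g S"
    by (simp_all add: assms(2) first_descendants_intros)
  with 1 assms(1) show ?thesis
    by (simp add: orbit_gf_tpair poly2_span_Y poly2_span_add)
next
  case (2 u v)
  then have "orbit_gf (u \<circ> v) \<in> poly2_span g S"
    using assms(2) first_descendants_intros(3) by metis
  then have "fps_X * (fps_const fps_X * orbit_gf (u \<circ> v)) \<in> poly2_span g S"
    by (intro poly2_span_X poly2_span_Y)
  moreover have "orbit_gf x = 1 + fps_X * (fps_const fps_X * orbit_gf (u \<circ> v))"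
    using 2 assms(1) orbit_gf_tpair_sigma by metis
  ultimately show ?thesis by simp
qed

lemma nth_descendants_add:
  "nth_descendants (m + n) w = (\<Union>x\<in>nth_descendants m w. nth_descendants n x)"
  by (induction n) auto

lemma first_descendants_subset_Desc: "first_descendants x \<subseteq> Desc x"
proof -
  have "nth_descendants 1 x \<subseteq> Desc x" unfolding Desc_def by blast
  then show ?thesis by simp
qed

lemma Desc_W: "x \<in> Desc w \<Longrightarrow> x \<in> W"
proof -
  assume "x \<in> Desc w"
  then obtain n where "n \<ge> 1" "x \<in> nth_descendants n w" by (auto simp: Desc_def)
  then show "x \<in> W" by (cases n) (auto dest: first_descendants_W)
qed

lemma Desc_trans: "y \<in> Desc x \<Longrightarrow> Desc y \<subseteq> Desc x"
proof
  fix z assume "y \<in> Desc x" "z \<in> Desc y"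
  then obtain m n where "m \<ge> 1" "y \<in> nth_descendants m x" "z \<in> nth_descendants n y"
    by (auto simp: Desc_def)
  then have "z \<in> nth_descendants (m + n) x" "m + n \<in> {1..}"
    by (auto simp: nth_descendants_add)
  then show "z \<in> Desc x" unfolding Desc_def by blast
qed

section \<open>The span of the irreducible descendants\<close>

lemma one_in_span_irreducible:
  assumes "w \<in> W" and fin: "finite (Desc w)"
  shows "1 \<in> poly2_span orbit_gf {x \<in> Desc w. Phi_irreducible x}" (is "_ \<in> poly2_span _ ?S")
proof -
  have "Desc w \<noteq> {}"
    using first_descendants_nonempty[OF \<open>w \<in> W\<close>] first_descendants_subset_Desc by blast
  then obtain x where x: "x \<in> Desc w" "\<And>y. y \<in> Desc w \<Longrightarrow> card (Desc x) \<le> card (Desc y)"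
    using ex_has_least_nat[of "\<lambda>x. x \<in> Desc w" _ "\<lambda>x. card (Desc x)"] by blast
  have finx: "finite (Desc x)"
    using Desc_trans[OF x(1)] fin finite_subset by blast
  \<comment> \<open>\<open>Desc y\<close> is contained in the finite set \<open>Desc x\<close> and,
    by minimality, is not smaller. So \<open>y\<close> lies in \<open>Desc y\<close>, which makes it
    irreducible.\<close>
  have eq: "Desc y = Desc x" if "y \<in> Desc x" for y
    using that x Desc_trans finx by (meson card_seteq subsetD)
  then have irr: "y \<in> ?S" if "y \<in> Desc x" for y
    using that finx Desc_trans[OF x(1)] by (auto simp: Phi_irreducible_def)
  \<comment> \<open>The minimal \<open>x\<close> need not lie in \<open>Desc x\<close>, but its
    first descendant \<open>y\<close> does, so the series of \<open>y\<close> itself is in the span.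
    Subtracting that series minus 1 leaves 1.\<close>
  obtain y where y: "y \<in> first_descendants x"
    using first_descendants_nonempty[OF Desc_W[OF x(1)]] by blast
  then have yx: "y \<in> Desc x" using first_descendants_subset_Desc by blast
  have S: "orbit_gf z \<in> poly2_span orbit_gf ?S" if "z \<in> Desc x" for z
    using irr[OF that] fin by (intro poly2_span_base) auto
  have "z \<in> Desc x" if "z \<in> first_descendants y" for z
    using that first_descendants_subset_Desc[of y] eq[OF yx] by blast
  then have "orbit_gf y - 1 \<in> poly2_span orbit_gf ?S"
    using S by (intro orbit_gf_minus_one_in_span Desc_W[OF yx]) blast
  from poly2_span_diff[OF S[OF yx] this] show ?thesis by simp
qed

text \<open>The spanning set stays attached to \<open>w\<close> while \<open>x\<close> varies.
  Requiring \<open>Desc x \<subseteq> Desc w\<close> instead of \<open>x \<in> Desc w\<close> allows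
  the case \<open>x = w\<close> even when \<open>w\<close> is reducible.\<close>

lemma orbit_gf_in_span_irreducible:
  assumes w: "w \<in> W" and fin: "finite (Desc w)"
    and x: "x \<in> W" "Desc x \<subseteq> Desc w"
  shows "orbit_gf x \<in> poly2_span orbit_gf {x \<in> Desc w. Phi_irreducible x}"
    (is "_ \<in> poly2_span _ ?S")
  using x
proof (induction "card (Desc x)" arbitrary: x rule: less_induct)
  case less
  have "orbit_gf y \<in> poly2_span orbit_gf ?S" if y: "y \<in> first_descendants x" for y
  proof (cases "y \<in> Desc y")
    case True
    have yx: "y \<in> Desc x" using y first_descendants_subset_Desc by blast
    then have "y \<in> Desc w" using less.prems(2) by blast
    moreover from this have "finite (Desc y)" using Desc_trans fin finite_subset by blast
    ultimately show ?thesis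
      using fin True by (intro poly2_span_base) (auto simp: Phi_irreducible_def)
  next
    case False
    have yx: "y \<in> Desc x" using y first_descendants_subset_Desc by blast
    \<comment> \<open>The inclusion is strict because \<open>y\<close> lies in \<open>Desc x\<close>
      but not in \<open>Desc y\<close>.\<close>
    then have "Desc y \<subset> Desc x" using Desc_trans False by blast
    moreover have "finite (Desc x)" using less.prems(2) fin finite_subset by blast
    ultimately show ?thesis
      using less.prems(2) Desc_W[OF yx] by (intro less.hyps psubset_card_mono) auto
  qed
  then have "orbit_gf x - 1 \<in> poly2_span orbit_gf ?S"
    using less.prems(1) by (intro orbit_gf_minus_one_in_span)
  from poly2_span_add[OF this one_in_span_irreducible[OF w fin]] show ?case by simp
qed

theorem theorem2p8:
  fixes w :: "word \<Rightarrow> word"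
  assumes "w \<in> W"
    and "Phi_finite w"
  shows "\<exists>c :: (word \<Rightarrow> word) \<Rightarrow> int poly poly.
           orbit_gf w =
             (\<Sum>w' \<in> {w' \<in> Desc w. Phi_irreducible w'}. fps2_of_poly2 (c w') * orbit_gf w')"
proof -
  have "orbit_gf w \<in> poly2_span orbit_gf {x \<in> Desc w. Phi_irreducible x}"
    using assms by (intro orbit_gf_in_span_irreducible) (auto simp: Phi_finite_def)
  then show ?thesis unfolding poly2_span_def by blast
qed

end
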